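(* Algebraic probability distributions with positive semi-definite support (i.e. supported in $[0,\infty)$) form a semi-group under free multiplicative convolution $\boxtimes$; that is, if $F^A$ and $F^B$ are algebraic probability distributions supported in $[0,\infty)$, then so is $F^A\boxtimes F^B$.
   Context: The Stieltjes transform of a probability distribution function $F$ on $\mathbb{R}$ is $m(z)=\int\frac{1}{x-z}\,dF(x)$ for $z\in\mathbb{C}^+$ (the open upper half plane), extended by the same formula to $z\notin\mathrm{supp}(dF)$. $F$ is algebraic if there is a nonzero bivariate polynomial $L(m,z)$ with real coefficients such that $L(m(z),z)=0$ for all $z\in\mathbb{C}^+$. Free multiplicative convolution: let $F$ be supported in $[0,\infty)$, not the point mass $\delta_0$ at $0$, with mass $\kappa<1$ at $0$. The function $y(z)=-z\,m(z)-1$ is a strictly monotone bijection from $(-\infty,0)$ onto $(\kappa-1,0)$; the S transform $s$ of $F$ is defined on $(\kappa-1,0)$ by $s(y(z))=\frac{m(z)}{z\,m(z)+1}$, equivalently $z=\frac{y+1}{y\,s(y)}$. For $F^A,F^B$ supported in $[0,\infty)$ and different from $\delta_0$, $F^A\boxtimes F^B$ is the unique probability distribution supported in $[0,\infty)$ whose S transform equals $s_A(y)s_B(y)$ on a common interval of definition $(-\varepsilon,0)$; if one of the two is $\delta_0$, then $F^A\boxtimes F^B=\delta_0$. *)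

theory Defs
  imports "HOL-Probability.Probability" "HOL-Computational_Algebra.Polynomial"
begin

text \<open>Probability distribution functions on the real line are represented by the associated
  Borel probability measures (\<^locale>\<open>real_distribution\<close>; see \<^const>\<open>cdf\<close> for the
  correspondence).\<close>

definition nonneg_distribution :: "real measure \<Rightarrow> bool" where
  "nonneg_distribution M \<longleftrightarrow> real_distribution M \<and> (AE x in M. 0 \<le> x)"

definition stieltjes :: "real measure \<Rightarrow> complex \<Rightarrow> complex" where
  "stieltjes M z = (LINT x|M. 1 / (complex_of_real x - z))"

text \<open>In \<open>L :: real poly poly\<close> the outer variable stands for \<open>m\<close> and the inner one for \<open>z\<close>.\<close>

definition poly_mz :: "real poly poly \<Rightarrow> complex \<Rightarrow> complex \<Rightarrow> complex" where
  "poly_mz L m z = poly (poly (map_poly (map_poly complex_of_real) L) [:m:]) z"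

definition algebraic_distribution :: "real measure \<Rightarrow> bool" where
  "algebraic_distribution M \<longleftrightarrow>
     (\<exists>L. L \<noteq> 0 \<and> (\<forall>z. 0 < Im z \<longrightarrow> poly_mz L (stieltjes M z) z = 0))"

definition y_fun :: "real measure \<Rightarrow> complex \<Rightarrow> complex" where
  "y_fun M z = - z * stieltjes M z - 1"

text \<open>The point mass at 0 has mass 1 at 0, and hence an empty S transform domain.\<close>

definition S_domain :: "real measure \<Rightarrow> real set" where
  "S_domain M = {measure M {0} - 1<..<0}"

text \<open>On \<^term>\<open>S_domain M\<close> the described \<open>z\<close> exists and is unique if \<open>M\<close> is supported in the
  nonnegative half-line; the transform takes real values there, although it is typed as complex.\<close>

definition S_transform :: "real measure \<Rightarrow> real \<Rightarrow> complex" where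
  "S_transform M y =
     (let z = complex_of_real (THE z. z < 0 \<and> y_fun M (complex_of_real z) = complex_of_real y)
      in stieltjes M z / (z * stieltjes M z + 1))"

text \<open>\<open>C\<close> is the free multiplicative convolution of \<open>A\<close> and \<open>B\<close>. In the non-degenerate case,
  the inclusion of a nonempty interval in \<^term>\<open>S_domain C\<close> forces \<open>C\<close> to differ from
  the point mass at 0.\<close>

definition is_free_mult_conv :: "real measure \<Rightarrow> real measure \<Rightarrow> real measure \<Rightarrow> bool" where
  "is_free_mult_conv A B C \<longleftrightarrow>
     nonneg_distribution C \<and>
     (if A = return borel 0 \<or> B = return borel 0 then C = return borel 0
      else \<exists>\<epsilon>>0. {-\<epsilon><..<0} \<subseteq> S_domain A \<inter> S_domain B \<inter> S_domain C \<and>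
             (\<forall>y\<in>{-\<epsilon><..<0}. S_transform C y = S_transform A y * S_transform B y))"

end

theory Submission
  imports Defs "Jordan_Normal_Form.Char_Poly" "HOL-Complex_Analysis.Complex_Analysis"
    "HOL-Real_Asymp.Real_Asymp"
begin

text \<open>On the negative axis everything is real. With \<open>y = - z * m - 1\<close> the functional equation of
  the S transforms says \<open>z\<^sub>A * z\<^sub>B = z\<^sub>C * (y + 1) / y\<close> for the inverse functions \<open>z\<^sub>A\<close>, \<open>z\<^sub>B\<close>,
  \<open>z\<^sub>C\<close> of \<open>y\<close>, where \<open>z\<^sub>A\<close> and \<open>z\<^sub>B\<close> are algebraic over the polynomials in \<open>y\<close>. Hence so is their
  product, being (up to a polynomial factor) an eigenvalue of a Kronecker product of companion
  matrices, whose characteristic polynomial is monic and thus nonzero. This yields a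
  polynomial relation for \<open>C\<close> on a left half-line, and the identity theorem on the plane slit
  along \<open>[0, \<infinity>)\<close> carries it to the upper half-plane, just as it carries the relations for \<open>A\<close> and
  \<open>B\<close> to the negative axis.\<close>

section \<open>Bivariate polynomials and their evaluation\<close>

text \<open>Counterpart of \<open>poly_mz\<close> over any commutative ring: the outer variable
  takes the value \<open>x\<close>, the inner one \<open>y\<close>. The roles change below: the pair
  is \<open>(m, z)\<close> for Stieltjes relations and \<open>(z, y)\<close> for relations between
  \<open>z\<close> and \<open>y\<close>.\<close>

definition eval2 :: "'a::comm_ring_1 poly poly \<Rightarrow> 'a \<Rightarrow> 'a \<Rightarrow> 'a" where
  "eval2 P x y = poly (poly P [:x:]) y"

lemma poly_ring_hom: "comm_ring_hom (\<lambda>p. poly p (y::'a::comm_ring_1))"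
  by unfold_locales auto

lemma eval2_altdef: "eval2 P x y = poly (map_poly (\<lambda>p. poly p y) P) x"
  by (induction P) (auto simp: eval2_def map_poly_pCons)

lemma eval2_eq_sum: "eval2 P x y = (\<Sum>k\<le>degree P. poly (coeff P k) y * x ^ k)"
  by (simp add: eval2_def poly_altdef[of P] poly_sum poly_power)

text \<open>Away from the zeros of the leading coefficient, fixing the inner variable leaves a
  nonzero univariate polynomial, and a field of characteristic 0 is infinite.\<close>

lemma eval2_nonzero_obtain:
  fixes P :: "'a::{field,ring_char_0} poly poly"
  assumes "P \<noteq> 0"
  obtains x y where "eval2 P x y \<noteq> 0"
proof -
  have "lead_coeff P \<noteq> 0"
    using assms by simp
  then obtain y where y: "poly (lead_coeff P) y \<noteq> 0"
    using poly_all_0_iff_0 by blast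
  let ?Q = "map_poly (\<lambda>p. poly p y) P"
  have "coeff ?Q (degree P) \<noteq> 0"
    using y by (simp add: coeff_map_poly)
  then have "?Q \<noteq> 0"
    by force
  then obtain x where "poly ?Q x \<noteq> 0"
    using poly_all_0_iff_0 by blast
  then show thesis
    using that[of x y] by (simp add: eval2_altdef)
qed

text \<open>Allows a polynomial to be obtained from a formula for its values by closure rules,
  without computing its coefficients.\<close>

definition polynomial_fun2 :: "('a::comm_ring_1 \<Rightarrow> 'a \<Rightarrow> 'a) \<Rightarrow> bool" where
  "polynomial_fun2 f \<longleftrightarrow> (\<exists>P. \<forall>x y. f x y = eval2 P x y)"

lemma polynomial_fun2_const: "polynomial_fun2 (\<lambda>x y. c)"
  unfolding polynomial_fun2_def by (rule exI[of _ "[:[:c:]:]"]) (simp add: eval2_def)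

lemma polynomial_fun2_fst: "polynomial_fun2 (\<lambda>x y. x)"
  unfolding polynomial_fun2_def by (rule exI[of _ "[:0, 1:]"]) (simp add: eval2_def)

lemma polynomial_fun2_snd: "polynomial_fun2 (\<lambda>x y. y)"
  unfolding polynomial_fun2_def by (rule exI[of _ "[:[:0, 1:]:]"]) (simp add: eval2_def)

lemma polynomial_fun2_add:
  "polynomial_fun2 f \<Longrightarrow> polynomial_fun2 g \<Longrightarrow> polynomial_fun2 (\<lambda>x y. f x y + g x y)"
  unfolding polynomial_fun2_def eval2_def by (metis poly_add)

lemma polynomial_fun2_mult:
  "polynomial_fun2 f \<Longrightarrow> polynomial_fun2 g \<Longrightarrow> polynomial_fun2 (\<lambda>x y. f x y * g x y)"
  unfolding polynomial_fun2_def eval2_def by (metis poly_mult)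

lemma polynomial_fun2_uminus:
  "polynomial_fun2 f \<Longrightarrow> polynomial_fun2 (\<lambda>x y. - f x y)"
  unfolding polynomial_fun2_def eval2_def by (metis poly_minus)

lemma polynomial_fun2_diff:
  "polynomial_fun2 f \<Longrightarrow> polynomial_fun2 g \<Longrightarrow> polynomial_fun2 (\<lambda>x y. f x y - g x y)"
  unfolding polynomial_fun2_def eval2_def by (metis poly_diff)

lemma polynomial_fun2_power:
  "polynomial_fun2 f \<Longrightarrow> polynomial_fun2 (\<lambda>x y. f x y ^ n)"
  by (induction n) (auto intro: polynomial_fun2_const polynomial_fun2_mult)

lemma polynomial_fun2_sum:
  "(\<And>k. k \<in> I \<Longrightarrow> polynomial_fun2 (f k)) \<Longrightarrow> polynomial_fun2 (\<lambda>x y. \<Sum>k\<in>I. f k x y)"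
  by (induction I rule: infinite_finite_induct)
    (auto intro: polynomial_fun2_const polynomial_fun2_add)

lemma polynomial_fun2_poly:
  "polynomial_fun2 f \<Longrightarrow> polynomial_fun2 (\<lambda>x y. poly p (f x y))"
  by (induction p) (auto intro: polynomial_fun2_const polynomial_fun2_add polynomial_fun2_mult)

lemmas polynomial_fun2_intros = polynomial_fun2_const polynomial_fun2_fst polynomial_fun2_snd
  polynomial_fun2_add polynomial_fun2_mult polynomial_fun2_uminus polynomial_fun2_diff
  polynomial_fun2_power polynomial_fun2_sum polynomial_fun2_poly

section \<open>Products of algebraic functions\<close>

text \<open>The companion matrix of \<open>\<Sum>k\<le>n. c k * z ^ k\<close>, scaled by the leading coefficient to
  avoid denominators: on the vector of powers of a root \<open>z\<close> it acts as multiplication by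
  \<open>c n * z\<close>.\<close>

definition companion_entry :: "nat \<Rightarrow> (nat \<Rightarrow> 'a::comm_ring_1) \<Rightarrow> nat \<Rightarrow> nat \<Rightarrow> 'a" where
  "companion_entry n c i j = (if Suc i < n then if j = Suc i then c n else 0 else - c j)"

lemma companion_entry_sum:
  fixes z :: "'a::comm_ring_1"
  assumes "i < n" "(\<Sum>k\<le>n. c k * z ^ k) = 0"
  shows "(\<Sum>j<n. companion_entry n c i j * z ^ j) = c n * z * z ^ i"
proof (cases "Suc i < n")
  case True
  have "(\<Sum>j<n. companion_entry n c i j * z ^ j) = (\<Sum>j<n. if j = Suc i then c n * z ^ j else 0)"
    using True by (intro sum.cong) (auto simp: companion_entry_def)
  then show ?thesis
    using True by (simp add: mult.assoc)
next
  case False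
  then have n: "n = Suc i"
    using assms by simp
  have "(\<Sum>j<n. companion_entry n c i j * z ^ j) = - (\<Sum>j<n. c j * z ^ j)"
    using False by (simp add: companion_entry_def sum_negf)
  \<comment> \<open>The last row is where the relation enters: it trades the lower terms for the
    leading one.\<close>
  also have "\<dots> = c n * z ^ n"
    using assms(2) by (simp add: lessThan_Suc_atMost[symmetric] neg_eq_iff_add_eq_0)
  finally show ?thesis
    by (simp add: n mult.assoc)
qed

text \<open>Index \<open>i\<close> stands for the pair \<open>(i div b, i mod b)\<close>. Entries in
  a ring are allowed so that the matrix can be formed over polynomials in \<open>y\<close> and
  specialised later.\<close>

definition kronecker_companion ::
  "nat \<Rightarrow> (nat \<Rightarrow> 'a::comm_ring_1) \<Rightarrow> nat \<Rightarrow> (nat \<Rightarrow> 'a) \<Rightarrow> 'a mat" where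
  "kronecker_companion a c b d = mat (a * b) (a * b)
     (\<lambda>(i, j). companion_entry a c (i div b) (j div b) * companion_entry b d (i mod b) (j mod b))"

lemma kronecker_companion_carrier [simp]:
  "kronecker_companion a c b d \<in> carrier_mat (a * b) (a * b)"
  by (simp add: kronecker_companion_def)

text \<open>The Kronecker product of the two vectors of powers is an eigenvector; its entry at index
  0 is 1, so it is nonzero. The scaling keeps this valid even where a leading coefficient
  vanishes.\<close>

lemma kronecker_companion_eigenvalue:
  fixes z w :: "'a::field"
  assumes ab: "0 < a" "0 < b"
    and z: "(\<Sum>k\<le>a. c k * z ^ k) = 0" and w: "(\<Sum>k\<le>b. d k * w ^ k) = 0"
  shows "poly (char_poly (kronecker_companion a c b d)) (c a * z * (d b * w)) = 0"
proof -
  define v where "v = vec (a * b) (\<lambda>i. z ^ (i div b) * w ^ (i mod b))"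
  let ?M = "kronecker_companion a c b d"
  have "?M *\<^sub>v v = (c a * z * (d b * w)) \<cdot>\<^sub>v v"
  proof (rule eq_vecI)
    fix i assume "i < dim_vec ((c a * z * (d b * w)) \<cdot>\<^sub>v v)"
    then have i: "i < a * b"
      by (simp add: v_def)
    then have i': "i div b < a" "i mod b < b"
      using ab by (simp_all add: less_mult_imp_div_less)
    let ?A = "companion_entry a c (i div b)" and ?B = "companion_entry b d (i mod b)"
    have "(?M *\<^sub>v v) $ i =
        (\<Sum>j<a*b. ?A (j div b) * ?B (j mod b) * (z ^ (j div b) * w ^ (j mod b)))"
      using i by (simp add: kronecker_companion_def v_def scalar_prod_def atLeast0LessThan)
    also have "\<dots> = (\<Sum>p<a. \<Sum>q<b. ?A p * ?B q * (z ^ p * w ^ q))"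
      using ab by (simp add: sum_mult_product)
    also have "\<dots> = (\<Sum>p<a. ?A p * z ^ p) * (\<Sum>q<b. ?B q * w ^ q)"
      unfolding sum_product by (simp add: mult_ac)
    also have "\<dots> = c a * z * z ^ (i div b) * (d b * w * w ^ (i mod b))"
      by (simp add: companion_entry_sum i' z w)
    also have "\<dots> = ((c a * z * (d b * w)) \<cdot>\<^sub>v v) $ i"
      using i by (simp add: v_def)
    finally show "(?M *\<^sub>v v) $ i = ((c a * z * (d b * w)) \<cdot>\<^sub>v v) $ i" .
  qed (simp add: v_def kronecker_companion_def)
  moreover have "v \<noteq> 0\<^sub>v (a * b)"
  proof
    assume "v = 0\<^sub>v (a * b)"
    then have "v $ 0 = 0\<^sub>v (a * b) $ 0"
      by simp
    then show False
      using ab by (simp add: v_def)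
  qed
  ultimately have "eigenvector ?M v (c a * z * (d b * w))"
    by (simp add: eigenvector_def v_def kronecker_companion_def)
  then show ?thesis
    using eigenvalue_root_char_poly[OF kronecker_companion_carrier] eigenvalue_def by blast
qed

text \<open>The characteristic polynomial \<open>X\<close> of the Kronecker matrix vanishes at the
  product of the roots times the leading coefficients, so \<open>R\<close> is \<open>X\<close> with
  its outer variable rescaled by their product \<open>\<gamma>\<close>. Positive degrees make the
  matrix nonempty.\<close>

lemma algebraic_product:
  fixes P Q :: "'a::{field,ring_char_0} poly poly"
  assumes "0 < degree P" "0 < degree Q"
  obtains R where "R \<noteq> 0"
    "\<And>x1 x2 y. eval2 P x1 y = 0 \<Longrightarrow> eval2 Q x2 y = 0 \<Longrightarrow> eval2 R (x1 * x2) y = 0"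
proof -
  let ?a = "degree P" and ?b = "degree Q"
  define K where "K = kronecker_companion ?a (coeff P) ?b (coeff Q)"
  define X where "X = char_poly K"
  define \<gamma> where "\<gamma> = lead_coeff P * lead_coeff Q"
  have K: "K \<in> carrier_mat (?a * ?b) (?a * ?b)"
    by (simp add: K_def)
  \<comment> \<open>Matrix entries are polynomials in \<open>y\<close>, and evaluation at
    \<open>y\<close> is a ring homomorphism, so it commutes with taking the characteristic
    polynomial.\<close>
  have X: "eval2 X t y = poly (char_poly (kronecker_companion ?a (\<lambda>k. poly (coeff P k) y)
      ?b (\<lambda>k. poly (coeff Q k) y))) t" for t y
  proof -
    have "map_mat (\<lambda>p. poly p y) K =
        kronecker_companion ?a (\<lambda>k. poly (coeff P k) y) ?b (\<lambda>k. poly (coeff Q k) y)"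
      by (rule eq_matI) (auto simp: K_def kronecker_companion_def companion_entry_def)
    then show ?thesis
      by (simp add: eval2_altdef X_def flip: comm_ring_hom.char_poly_hom[OF poly_ring_hom K])
  qed
  have "polynomial_fun2 (\<lambda>x y. \<Sum>k\<le>degree X. poly (coeff X k) y * (poly \<gamma> y * x) ^ k)"
    by (intro polynomial_fun2_intros)
  then obtain R where R: "\<And>x y. eval2 X (poly \<gamma> y * x) y = eval2 R x y"
    unfolding polynomial_fun2_def eval2_eq_sum[symmetric] by metis
  show thesis
  proof
    have "\<gamma> \<noteq> 0"
      using assms by (auto simp: \<gamma>_def)
    then obtain y where y: "poly \<gamma> y \<noteq> 0"
      using poly_all_0_iff_0 by blast
    \<comment> \<open>Monicity survives specialisation: the coefficient of index
      \<open>?a * ?b\<close> is 1 for every \<open>y\<close>.\<close>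
    have "map_poly (\<lambda>p. poly p y) X \<noteq> 0"
    proof
      assume "map_poly (\<lambda>p. poly p y) X = 0"
      then have "coeff (map_poly (\<lambda>p. poly p y) X) (?a * ?b) = 0"
        by simp
      then show False
        using degree_monic_char_poly[OF K] by (simp add: coeff_map_poly X_def)
    qed
    then obtain t where "eval2 X t y \<noteq> 0"
      unfolding eval2_altdef using poly_all_0_iff_0 by blast
    then have "eval2 R (t / poly \<gamma> y) y \<noteq> 0"
      using y by (simp flip: R)
    then show "R \<noteq> 0"
      by (auto simp: eval2_def)
  next
    fix x1 x2 y assume "eval2 P x1 y = 0" "eval2 Q x2 y = 0"
    then have "eval2 X (poly (lead_coeff P) y * x1 * (poly (lead_coeff Q) y * x2)) y = 0"
      unfolding X using assms
      by (intro kronecker_companion_eigenvalue) (simp_all add: eval2_eq_sum)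
    then show "eval2 R (x1 * x2) y = 0"
      by (simp add: R[symmetric] \<gamma>_def mult_ac)
  qed
qed

section \<open>Elimination between relations in \<open>m\<close>, \<open>z\<close> and
  \<open>y\<close>\<close>

text \<open>Substituting \<open>m = - (y + 1) / z\<close> and clearing denominators with
  \<open>z ^ degree L\<close> turns a relation between \<open>m\<close> and \<open>z\<close> into
  one between \<open>z\<close> and \<open>y\<close>.\<close>

lemma y_relation_of_m_relation:
  fixes L :: "'a::{field,ring_char_0} poly poly"
  assumes "L \<noteq> 0"
  obtains P where "0 < degree P"
    "\<And>y z. z \<noteq> 0 \<Longrightarrow> eval2 L (- (y + 1) / z) z = 0 \<Longrightarrow> eval2 P z y = 0"
proof -
  let ?n = "degree L"
  have "polynomial_fun2 (\<lambda>z y. \<Sum>k\<le>?n. poly (coeff L k) z * ((- (y + 1)) ^ k * z ^ (?n - k)))"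
    by (intro polynomial_fun2_intros)
  then obtain P where P: "\<And>z y.
      eval2 P z y = (\<Sum>k\<le>?n. poly (coeff L k) z * ((- (y + 1)) ^ k * z ^ (?n - k)))"
    unfolding polynomial_fun2_def by metis
  have P': "eval2 P z y = z ^ ?n * eval2 L (- (y + 1) / z) z" if "z \<noteq> 0" for z y
    unfolding P unfolding eval2_eq_sum sum_distrib_left
  proof (rule sum.cong)
    fix k assume "k \<in> {..?n}"
    then have "z ^ ?n = z ^ k * z ^ (?n - k)"
      by (simp flip: power_add)
    then show "poly (coeff L k) z * ((- (y + 1)) ^ k * z ^ (?n - k)) =
        z ^ ?n * (poly (coeff L k) z * (- (y + 1) / z) ^ k)"
      using that by (simp add: power_divide)
  qed simp
  \<comment> \<open>The extra factor \<open>z\<close> forces the chosen non-root to have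
    \<open>z \<noteq> 0\<close>; there \<open>y = - z * m - 1\<close> inverts the
    substitution.\<close>
  have "[:[:0, 1:]:] * L \<noteq> 0"
    using assms by simp
  then obtain m z where "eval2 ([:[:0, 1:]:] * L) m z \<noteq> 0"
    using eval2_nonzero_obtain by blast
  then have mz: "z \<noteq> 0" "eval2 L m z \<noteq> 0"
    by (auto simp: eval2_def)
  have "eval2 P z (- z * m - 1) \<noteq> 0"
    using mz by (subst P') auto
  then have "P \<noteq> 0"
    by (auto simp: eval2_def)
  show thesis
  proof
    \<comment> \<open>Multiplying \<open>P\<close> by its outer variable makes the degree positive
      even if \<open>P\<close> is constant in \<open>z\<close>.\<close>
    show "0 < degree (pCons 0 P)"
      using \<open>P \<noteq> 0\<close> by simp
    show "eval2 (pCons 0 P) z y = 0" if "z \<noteq> 0" "eval2 L (- (y + 1) / z) z = 0" for y z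
      using that P' by (simp add: eval2_def)
  qed
qed

text \<open>The relations of \<open>z1\<close> and \<open>z2\<close> over \<open>y\<close> give one
  for their product \<open>z * (y + 1) / y\<close>; going back to \<open>m\<close> and
  \<open>z\<close> by \<open>y = - z * m - 1\<close> turns this into a relation for the third
  transform.\<close>

lemma multiplicative_elimination:
  fixes L1 L2 :: "'a::{field,ring_char_0} poly poly"
  assumes "L1 \<noteq> 0" "L2 \<noteq> 0"
  obtains L where "L \<noteq> 0"
    "\<And>y z z1 z2. \<lbrakk>y \<noteq> 0; z \<noteq> 0; z1 \<noteq> 0; z2 \<noteq> 0; z1 * z2 = z * (y + 1) / y;
       eval2 L1 (- (y + 1) / z1) z1 = 0; eval2 L2 (- (y + 1) / z2) z2 = 0\<rbrakk>
      \<Longrightarrow> eval2 L (- (y + 1) / z) z = 0"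
proof -
  obtain P1 where P1: "0 < degree P1"
    "\<And>y z. z \<noteq> 0 \<Longrightarrow> eval2 L1 (- (y + 1) / z) z = 0 \<Longrightarrow> eval2 P1 z y = 0"
    using y_relation_of_m_relation[OF assms(1)] by blast
  obtain P2 where P2: "0 < degree P2"
    "\<And>y z. z \<noteq> 0 \<Longrightarrow> eval2 L2 (- (y + 1) / z) z = 0 \<Longrightarrow> eval2 P2 z y = 0"
    using y_relation_of_m_relation[OF assms(2)] by blast
  obtain R where R: "R \<noteq> 0"
    "\<And>x1 x2 y. eval2 P1 x1 y = 0 \<Longrightarrow> eval2 P2 x2 y = 0 \<Longrightarrow> eval2 R (x1 * x2) y = 0"
    using algebraic_product[OF P1(1) P2(1)] by metis
  let ?n = "degree R"
  \<comment> \<open>Since \<open>y + 1 = - z * m\<close>, the product is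
    \<open>- (z ^ 2 * m) / y\<close>; the powers of \<open>- z * m - 1\<close> clear the denominator
    \<open>y\<close>.\<close>
  have "polynomial_fun2 (\<lambda>m z. \<Sum>k\<le>?n. poly (coeff R k) (- z * m - 1) *
      ((- (z ^ 2 * m)) ^ k * (- z * m - 1) ^ (?n - k)))"
    by (intro polynomial_fun2_intros)
  then obtain L where L: "\<And>m z. eval2 L m z = (\<Sum>k\<le>?n. poly (coeff R k) (- z * m - 1) *
      ((- (z ^ 2 * m)) ^ k * (- z * m - 1) ^ (?n - k)))"
    unfolding polynomial_fun2_def by metis
  have L': "eval2 L (- (y + 1) / z) z = y ^ ?n * eval2 R (z * (y + 1) / y) y"
    if "y \<noteq> 0" "z \<noteq> 0" for y z
  proof -
    have *: "- z * (- (y + 1) / z) - 1 = y" "- (z ^ 2 * (- (y + 1) / z)) = z * (y + 1)"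
      using that by (simp_all add: power2_eq_square field_simps)
    show ?thesis
      unfolding L * unfolding eval2_eq_sum sum_distrib_left
    proof (rule sum.cong)
      fix k assume "k \<in> {..?n}"
      then have "y ^ ?n = y ^ k * y ^ (?n - k)"
        by (simp flip: power_add)
      then show "poly (coeff R k) y * ((z * (y + 1)) ^ k * y ^ (?n - k)) =
          y ^ ?n * (poly (coeff R k) y * (z * (y + 1) / y) ^ k)"
        using that by (simp add: power_divide)
    qed simp
  qed
  show thesis
  proof
    \<comment> \<open>The factor evaluates to \<open>w * y * (1 + y)\<close>, so a non-root avoids
      the three values at which \<open>z = w * y / (y + 1)\<close> would be undefined or zero or the
      substitution would fail.\<close>
    have "[:0, [:0, 1, 1:]:] * R \<noteq> 0"
      using R(1) by simp
    then obtain w y where "eval2 ([:0, [:0, 1, 1:]:] * R) w y \<noteq> 0"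
      using eval2_nonzero_obtain by blast
    moreover have "eval2 ([:0, [:0, 1, 1:]:] * R) w y = w * y * (1 + y) * eval2 R w y"
      by (simp add: eval2_def algebra_simps)
    ultimately have wy: "w \<noteq> 0" "y \<noteq> 0" "1 + y \<noteq> 0" "eval2 R w y \<noteq> 0"
      by auto
    define z where "z = w * y / (y + 1)"
    have "z \<noteq> 0" "z * (y + 1) / y = w"
      using wy by (simp_all add: z_def add.commute)
    then have "eval2 L (- (y + 1) / z) z \<noteq> 0"
      using L'[of y z] wy by simp
    then show "L \<noteq> 0"
      by (auto simp: eval2_def)
  next
    fix y z z1 z2
    assume "y \<noteq> 0" "z \<noteq> 0" "z1 \<noteq> 0" "z2 \<noteq> 0" "z1 * z2 = z * (y + 1) / y"
       "eval2 L1 (- (y + 1) / z1) z1 = 0" "eval2 L2 (- (y + 1) / z2) z2 = 0"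
    then show "eval2 L (- (y + 1) / z) z = 0"
      using R(2)[of z1 y z2] P1(2)[of z1 y] P2(2)[of z2 y] L'[of y z] by simp
  qed
qed

section \<open>Complex evaluation and the slit plane\<close>

lemma poly_mz_0: "poly_mz 0 m z = 0"
  by (simp add: poly_mz_def)

lemma poly_mz_pCons:
  "poly_mz (pCons p L) m z = poly (map_poly complex_of_real p) z + m * poly_mz L m z"
  by (simp add: poly_mz_def Polynomial.map_poly_pCons)

lemma poly_mz_of_real: "poly_mz L (of_real m) (of_real z) = of_real (eval2 L m z)"
proof (induction L)
  case (pCons p L)
  have "poly (map_poly complex_of_real p) (of_real z) = of_real (poly p z)"
    by (induction p) (auto simp: map_poly_pCons)
  then show ?case
    using pCons by (simp add: poly_mz_pCons eval2_def)
qed (simp add: poly_mz_0 eval2_def)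

lemma holomorphic_on_poly_mz:
  assumes "f holomorphic_on S"
  shows "(\<lambda>z. poly_mz L (f z) z) holomorphic_on S"
proof (induction L)
  case (pCons p L)
  then show ?case
    unfolding poly_mz_pCons by (intro holomorphic_intros assms)
qed (simp add: poly_mz_0)

text \<open>A connected open set that contains both the upper half-plane and the negative axis and
  avoids the support.\<close>

abbreviation slit_plane :: "complex set" where
  "slit_plane \<equiv> - complex_of_real ` {0..}"

lemma open_slit_plane: "open slit_plane"
  using closed_slot_right by (simp add: open_Compl)

lemma connected_slit_plane: "connected slit_plane"
  by (rule starlike_imp_connected[OF starlike_slotted_complex_plane_right])

lemma of_real_in_slit_plane: "z < 0 \<Longrightarrow> complex_of_real z \<in> slit_plane"
  by auto

lemma upper_half_plane_subset_slit_plane: "{z. 0 < Im z} \<subseteq> slit_plane"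
  by auto

lemma slit_plane_distance:
  assumes "z \<in> slit_plane"
  obtains d where "0 < d" "\<And>x. 0 \<le> x \<Longrightarrow> d \<le> norm (complex_of_real x - z)"
proof -
  obtain d where d: "0 < d" "ball z d \<subseteq> slit_plane"
    using assms open_slit_plane open_contains_ball by blast
  show thesis
  proof
    fix x :: real assume "0 \<le> x"
    then have "complex_of_real x \<notin> ball z d"
      using d(2) by blast
    then show "d \<le> norm (complex_of_real x - z)"
      by (simp add: dist_norm norm_minus_commute)
  qed (rule d(1))
qed

section \<open>Holomorphy of the Stieltjes transform and continuation of relations\<close>

locale nonneg_real_distribution = real_distribution +
  assumes AE_nonneg: "AE x in M. 0 \<le> x"
begin

lemma integrable_AE_bound:
  fixes f :: "real \<Rightarrow> 'b::{banach,second_countable_topology}"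
  assumes "f \<in> borel_measurable borel" "\<And>x. 0 \<le> x \<Longrightarrow> norm (f x) \<le> B"
  shows "integrable M f"
proof (rule integrable_const_bound)
  show "AE x in M. norm (f x) \<le> B"
    using AE_nonneg by eventually_elim (rule assms(2))
  show "f \<in> borel_measurable M"
    using assms(1) by simp
qed

lemma integral_norm_AE_bound:
  fixes f :: "real \<Rightarrow> 'b::{banach,second_countable_topology}"
  assumes "f \<in> borel_measurable borel" "\<And>x. 0 \<le> x \<Longrightarrow> norm (f x) \<le> B"
  shows "norm (LINT x|M. f x) \<le> B"
proof -
  have "(LINT x|M. norm (f x)) \<le> B"
  proof (rule integral_le_const)
    show "AE x in M. norm (f x) \<le> B"
      using AE_nonneg by eventually_elim (rule assms(2))
  qed (intro integrable_norm integrable_AE_bound[OF assms])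
  then show ?thesis
    using integral_norm_bound[of M f] by linarith
qed

text \<open>The difference quotient minus the candidate derivative is the integral of
  \<open>(w - z) / ((x - w) * (x - z) ^ 2)\<close>, which is at most a constant times
  \<open>norm (w - z)\<close> because both denominators stay away from 0 on the support.\<close>

lemma stieltjes_has_field_derivative:
  assumes "z \<in> slit_plane"
  shows "(stieltjes M has_field_derivative (LINT x|M. 1 / (complex_of_real x - z) ^ 2)) (at z)"
proof -
  obtain d where d: "0 < d" "\<And>x. 0 \<le> x \<Longrightarrow> d \<le> norm (complex_of_real x - z)"
    using slit_plane_distance[OF assms] by blast
  have "eventually (\<lambda>w. norm ((stieltjes M w - stieltjes M z) / (w - z)
      - (LINT x|M. 1 / (complex_of_real x - z) ^ 2)) \<le> norm (w - z) * (2 / d ^ 3)) (at z)"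
    unfolding eventually_at
  proof (intro exI[of _ "d / 2"] conjI ballI impI)
    fix w :: complex assume w: "w \<noteq> z \<and> dist w z < d / 2"
    \<comment> \<open>Moving \<open>z\<close> by less than \<open>d / 2\<close> costs at most half
      of its distance to the support.\<close>
    have dw: "d / 2 \<le> norm (complex_of_real x - w)" if "0 \<le> x" for x
    proof -
      have "norm (complex_of_real x - z) \<le> norm (complex_of_real x - w) + norm (w - z)"
        using norm_triangle_ineq[of "complex_of_real x - w" "w - z"] by simp
      then show ?thesis
        using d(2)[OF that] w by (simp add: dist_norm)
    qed
    have int: "integrable M (\<lambda>x. 1 / (complex_of_real x - w))"
      "integrable M (\<lambda>x. 1 / (complex_of_real x - z))"
      "integrable M (\<lambda>x. 1 / (complex_of_real x - z) ^ 2)"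
    proof -
      show "integrable M (\<lambda>x. 1 / (complex_of_real x - w))"
        using d(1) frac_le[of 1 1 "d / 2"] dw
        by (intro integrable_AE_bound[where B = "1 / (d / 2)"]) (simp_all add: norm_divide)
      show "integrable M (\<lambda>x. 1 / (complex_of_real x - z))"
        using d by (intro integrable_AE_bound[where B = "1 / d"])
          (auto simp: norm_divide intro!: frac_le)
      show "integrable M (\<lambda>x. 1 / (complex_of_real x - z) ^ 2)"
        using d by (intro integrable_AE_bound[where B = "1 / d ^ 2"])
          (auto simp: norm_divide norm_power intro!: frac_le power_mono)
    qed
    have "(stieltjes M w - stieltjes M z) / (w - z) - (LINT x|M. 1 / (complex_of_real x - z) ^ 2)
        = (LINT x|M. (1 / (complex_of_real x - w) - 1 / (complex_of_real x - z)) / (w - z)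
            - 1 / (complex_of_real x - z) ^ 2)"
      using int by (simp add: stieltjes_def)
    also have "\<dots> = (LINT x|M. (w - z) / ((complex_of_real x - w) * (complex_of_real x - z) ^ 2))"
    proof (rule integral_cong_AE)
      show "AE x in M. (1 / (complex_of_real x - w) - 1 / (complex_of_real x - z)) / (w - z)
            - 1 / (complex_of_real x - z) ^ 2 =
          (w - z) / ((complex_of_real x - w) * (complex_of_real x - z) ^ 2)"
        using AE_nonneg
      proof eventually_elim
        case (elim x)
        define a b where "a = complex_of_real x - w" and "b = complex_of_real x - z"
        have ab: "a \<noteq> 0" "b \<noteq> 0" "b - a \<noteq> 0" and "w - z = b - a"
          using dw[OF elim] d(1) d(2)[OF elim] w by (auto simp: a_def b_def)
        moreover have "(1 / a - 1 / b) / (b - a) = 1 / (a * b)"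
          using ab by (simp add: divide_simps)
        moreover have "1 / (a * b) - 1 / b ^ 2 = (b - a) / (a * b ^ 2)"
          using ab(1,2) by (simp add: divide_simps power2_eq_square)
        ultimately show ?case
          unfolding a_def[symmetric] b_def[symmetric] by simp
      qed
    qed measurable
    also have "norm \<dots> \<le> norm (w - z) * (2 / d ^ 3)"
    proof (rule integral_norm_AE_bound)
      fix x :: real assume x: "0 \<le> x"
      have "norm (w - z) / (norm (complex_of_real x - w) * norm (complex_of_real x - z) ^ 2)
          \<le> norm (w - z) / (d / 2 * d ^ 2)"
        using d(1) d(2)[OF x] dw[OF x]
        by (intro frac_le mult_mono power_mono mult_pos_pos) auto
      then show "norm ((w - z) / ((complex_of_real x - w) * (complex_of_real x - z) ^ 2))
          \<le> norm (w - z) * (2 / d ^ 3)"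
        by (simp add: norm_divide norm_mult norm_power power3_eq_cube power2_eq_square mult_ac)
    qed measurable
    finally show "norm ((stieltjes M w - stieltjes M z) / (w - z)
      - (LINT x|M. 1 / (complex_of_real x - z) ^ 2)) \<le> norm (w - z) * (2 / d ^ 3)" .
  qed (use d in auto)
  moreover have "((\<lambda>w. norm (w - z) * (2 / d ^ 3)) \<longlongrightarrow> 0) (at z)"
    by (rule tendsto_eq_intros refl | simp)+
  ultimately have "((\<lambda>w. (stieltjes M w - stieltjes M z) / (w - z)
      - (LINT x|M. 1 / (complex_of_real x - z) ^ 2)) \<longlongrightarrow> 0) (at z)"
    by (rule Lim_null_comparison)
  then show ?thesis
    by (simp add: has_field_derivative_iff Lim_null[of _ "LINT x|M. _ x"])
qed

lemma holomorphic_stieltjes: "stieltjes M holomorphic_on slit_plane"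
  unfolding holomorphic_on_def field_differentiable_def
  using stieltjes_has_field_derivative has_field_derivative_at_within by blast

definition real_stieltjes :: "real \<Rightarrow> real" where
  "real_stieltjes z = (LINT x|M. 1 / (x - z))"

lemma stieltjes_of_real: "stieltjes M (complex_of_real z) = of_real (real_stieltjes z)"
proof -
  have "stieltjes M (complex_of_real z) = (LINT x|M. complex_of_real (1 / (x - z)))"
    by (simp add: stieltjes_def)
  then show ?thesis
    by (simp only: integral_complex_of_real real_stieltjes_def)
qed

lemma algebraic_relation_negative_axis:
  assumes "\<And>z. 0 < Im z \<Longrightarrow> poly_mz L (stieltjes M z) z = 0"
    and "z < 0"
  shows "eval2 L (real_stieltjes z) z = 0"
proof -
  have "poly_mz L (stieltjes M (of_real z)) (of_real z) = 0"
  proof (rule analytic_continuation_open[where s = "{z. 0 < Im z}" and s' = slit_plane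
        and f = "\<lambda>z. poly_mz L (stieltjes M z) z" and g = "\<lambda>_. 0"])
    have "\<i> \<in> {z. 0 < Im z}"
      by simp
    then show "{z. 0 < Im z} \<noteq> {}"
      by blast
    show "complex_of_real z \<in> slit_plane"
      using assms(2) by (rule of_real_in_slit_plane)
  qed (use assms(1) open_slit_plane connected_slit_plane upper_half_plane_subset_slit_plane in
      \<open>auto intro!: holomorphic_on_poly_mz holomorphic_stieltjes open_halfspace_Im_gt\<close>)
  then show ?thesis
    by (simp add: stieltjes_of_real poly_mz_of_real)
qed

text \<open>A half-line is not open in the plane, so the identity theorem is used in its limit-point
  form, at the interior point \<open>c - 1\<close>.\<close>

lemma algebraic_relation_upper_half_plane:
  assumes "\<And>z. z < c \<Longrightarrow> eval2 L (real_stieltjes z) z = 0"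
    and "c \<le> 0" "0 < Im z"
  shows "poly_mz L (stieltjes M z) z = 0"
proof (rule analytic_continuation[where S = slit_plane and U = "complex_of_real ` {..<c}"
      and \<xi> = "of_real (c - 1)" and f = "\<lambda>z. poly_mz L (stieltjes M z) z"])
  show "(\<lambda>z. poly_mz L (stieltjes M z) z) holomorphic_on slit_plane"
    by (intro holomorphic_on_poly_mz holomorphic_stieltjes)
  show "complex_of_real ` {..<c} \<subseteq> slit_plane"
    using assms(2) by auto
  show "complex_of_real (c - 1) \<in> slit_plane"
    using assms(2) by (intro of_real_in_slit_plane) simp
  show "complex_of_real (c - 1) islimpt complex_of_real ` {..<c}"
    unfolding islimpt_approachable
  proof (intro allI impI)
    fix e :: real assume "0 < e"
    then have "complex_of_real (c - 1 - e / 2) \<noteq> of_real (c - 1)"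
      "dist (complex_of_real (c - 1 - e / 2)) (of_real (c - 1)) < e"
      unfolding of_real_eq_iff dist_of_real by (auto simp: dist_real_def)
    moreover have "complex_of_real (c - 1 - e / 2) \<in> complex_of_real ` {..<c}"
      using \<open>0 < e\<close> by (intro imageI) simp
    ultimately show "\<exists>x'\<in>complex_of_real ` {..<c}.
        x' \<noteq> of_real (c - 1) \<and> dist x' (of_real (c - 1)) < e"
      by blast
  qed
  show "poly_mz L (stieltjes M w) w = 0" if "w \<in> complex_of_real ` {..<c}" for w
    using that assms(1) by (auto simp: stieltjes_of_real poly_mz_of_real)
  show "z \<in> slit_plane"
    using assms(3) by auto
qed (rule open_slit_plane connected_slit_plane)+

section \<open>The function \<open>y\<close> on the negative axis\<close>

definition real_y :: "real \<Rightarrow> real" where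
  "real_y z = - z * real_stieltjes z - 1"

lemma y_fun_of_real: "y_fun M (of_real z) = of_real (real_y z)"
  by (simp add: y_fun_def real_y_def stieltjes_of_real)

lemma real_stieltjes_eq: "z < 0 \<Longrightarrow> real_stieltjes z = - (real_y z + 1) / z"
  by (simp add: real_y_def)

lemma kernel_bound: "z < 0 \<Longrightarrow> 0 \<le> x \<Longrightarrow> norm (- x / (x - z)) \<le> 1" for x z :: real
  by (simp add: abs_divide divide_simps)

lemma integrable_kernel: "z < 0 \<Longrightarrow> integrable M (\<lambda>x. - x / (x - z))"
  by (intro integrable_AE_bound[where B = 1] kernel_bound) measurable

text \<open>This kernel is bounded by 1 on the support uniformly in \<open>z < 0\<close>, and its
  sign and monotonicity in \<open>z\<close> are visible.\<close>

lemma real_y_eq_integral: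
  assumes "z < 0"
  shows "real_y z = (LINT x|M. - x / (x - z))"
proof -
  have "norm (1 / (x - z)) \<le> 1 / - z" if "0 \<le> x" for x
    using that assms frac_le[of 1 1 "- z" "x - z"] by (simp add: abs_divide)
  then have "integrable M (\<lambda>x. 1 / (x - z))"
    by (intro integrable_AE_bound) measurable
  then have "integrable M (\<lambda>x. - z * (1 / (x - z)))"
    by (rule integrable_mult_right)
  then have "(LINT x|M. - z * (1 / (x - z)) - 1) = (LINT x|M. - z * (1 / (x - z))) - 1"
    by (subst Bochner_Integration.integral_diff) (simp_all add: prob_space[unfolded space_eq_univ])
  then have "real_y z = (LINT x|M. - z * (1 / (x - z)) - 1)"
    unfolding real_y_def real_stieltjes_def by (simp only: integral_mult_right_zero)
  also have "\<dots> = (LINT x|M. - x / (x - z))"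
  proof (rule integral_cong_AE)
    show "AE x in M. - z * (1 / (x - z)) - 1 = - x / (x - z)"
      using AE_nonneg by eventually_elim (use assms in \<open>simp add: field_simps\<close>)
  qed measurable
  finally show ?thesis .
qed

text \<open>Dominated convergence with the constant bound 1, so no moments are required;
  \<open>z = - t\<close> moves the limit to \<open>at_top\<close>.\<close>

lemma real_y_tendsto_0: "(real_y \<longlongrightarrow> 0) at_bot"
proof -
  have "((\<lambda>t. LINT x|M. - x / (x - (- t))) \<longlongrightarrow> (LINT x|M. 0)) at_top"
  proof (rule integral_dominated_convergence_at_top[where w = "\<lambda>_. 1"])
    show "AE x in M. ((\<lambda>t. - x / (x - (- t))) \<longlongrightarrow> 0) at_top"
      by (intro AE_I2) real_asymp
    show "\<forall>\<^sub>F t in at_top. AE x in M. norm (- x / (x - (- t))) \<le> 1"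
      using eventually_gt_at_top[of 0]
    proof eventually_elim
      case (elim t)
      show ?case
        using AE_nonneg by eventually_elim (use elim in \<open>intro kernel_bound; simp\<close>)
    qed
    show "(\<lambda>x. - x / (x - (- t))) \<in> borel_measurable M" for t
      by measurable
  qed simp_all
  then have "((\<lambda>t. LINT x|M. - x / (x - (- t))) \<longlongrightarrow> 0) at_top"
    by simp
  moreover have "eventually (\<lambda>t. (LINT x|M. - x / (x - (- t))) = real_y (- t)) at_top"
    using eventually_gt_at_top[of 0] by eventually_elim (simp add: real_y_eq_integral)
  ultimately have "((\<lambda>t. real_y (- t)) \<longlongrightarrow> 0) at_top"
    by (rule Lim_transform_eventually)
  then show ?thesis
    by (simp add: filterlim_at_bot_mirror)
qed

lemma continuous_on_real_y: "continuous_on {..<0} real_y"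
proof -
  have "continuous_on {..<0} (\<lambda>z. Re (stieltjes M (of_real z)))"
    by (intro continuous_intros continuous_on_compose2[OF
        holomorphic_on_imp_continuous_on[OF holomorphic_stieltjes]]) auto
  then have "continuous_on {..<0} real_stieltjes"
    by (simp add: stieltjes_of_real)
  then show ?thesis
    unfolding real_y_def by (intro continuous_intros)
qed

end

section \<open>Inverting \<open>y\<close> and computing the S transform\<close>

locale nondegenerate_nonneg_distribution = nonneg_real_distribution +
  assumes mass_at_0: "measure M {0} < 1"
begin

text \<open>Positive mass on the open half-line is what makes the integral inequalities below
  strict.\<close>

lemma emeasure_pos: "emeasure M {0<..} \<noteq> 0"
proof
  assume "emeasure M {0<..} = 0"
  then have "AE x in M. x \<notin> {0<..}"
    by (intro AE_not_in) (auto simp: null_sets_def)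
  then have "AE x in M. x \<in> {0}"
    using AE_nonneg by eventually_elim auto
  then have "prob {0} = 1"
    by (subst prob_eq_1) auto
  then show False
    using mass_at_0 by simp
qed

lemma real_y_neg:
  assumes "z < 0"
  shows "real_y z < 0"
proof -
  have "(LINT x|M. - x / (x - z)) < (LINT x|M. 0)"
  proof (rule integral_less_AE[where A = "{0<..}"])
    show "AE x in M. - x / (x - z) \<le> 0"
      using AE_nonneg by eventually_elim (use assms in \<open>simp add: divide_simps\<close>)
    show "AE x in M. x \<in> {0<..} \<longrightarrow> - x / (x - z) \<noteq> 0"
      using assms by (intro AE_I2) auto
  qed (use assms integrable_kernel emeasure_pos in auto)
  then show ?thesis
    using assms by (simp add: real_y_eq_integral)
qed

text \<open>For fixed \<open>x > 0\<close> the kernel \<open>- x / (x - z)\<close> strictly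
  decreases in \<open>z < 0\<close>; at \<open>x = 0\<close> it is constant.\<close>

lemma real_y_strict_antimono:
  assumes "u < v" "v < 0"
  shows "real_y v < real_y u"
proof -
  have less: "- x / (x - v) < - x / (x - u)" if "0 < x" for x
    unfolding divide_minus_left neg_less_iff_less
    using that assms by (intro divide_strict_left_mono mult_pos_pos) auto
  have "(LINT x|M. - x / (x - v)) < (LINT x|M. - x / (x - u))"
  proof (rule integral_less_AE[where A = "{0<..}"])
    show "AE x in M. - x / (x - v) \<le> - x / (x - u)"
      using AE_nonneg
    proof eventually_elim
      case (elim x)
      then show ?case
        using less[of x] by (cases "x = 0") auto
    qed
    show "AE x in M. x \<in> {0<..} \<longrightarrow> - x / (x - v) \<noteq> - x / (x - u)"
      using less by (intro AE_I2) force
  qed (use assms integrable_kernel emeasure_pos in auto)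
  then show ?thesis
    using assms by (simp add: real_y_eq_integral)
qed

lemma real_y_inj:
  assumes "real_y u = real_y v" "u < 0" "v < 0"
  shows "u = v"
proof (cases u v rule: linorder_cases)
  case less
  then show ?thesis
    using real_y_strict_antimono[OF less assms(3)] assms(1) by linarith
next
  case greater
  then show ?thesis
    using real_y_strict_antimono[OF greater assms(2)] assms(1) by linarith
qed

text \<open>Intermediate values between a point far to the left, where \<open>real_y\<close> is
  close to 0, and the arbitrary base point \<open>- 1\<close>. Values close to 0 are all that the S
  transform equation calls for.\<close>

lemma real_y_surj:
  assumes "real_y (- 1) < y" "y < 0"
  obtains z where "z < 0" "real_y z = y"
proof -
  have "eventually (\<lambda>z. y < real_y z) at_bot"
    using order_tendstoD(1)[OF real_y_tendsto_0 assms(2)] .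
  then have "eventually (\<lambda>z. y < real_y z \<and> z < - 1) at_bot"
    using eventually_gt_at_bot[of "- 1 :: real"] by eventually_elim simp
  then obtain u where u: "y < real_y u" "u < - 1"
    unfolding eventually_at_bot_linorder by blast
  have "continuous_on {u..- 1} real_y"
    by (rule continuous_on_subset[OF continuous_on_real_y]) auto
  then obtain z where "u \<le> z" "z \<le> - 1" "real_y z = y"
    using IVT2'[of real_y "- 1" y u] u assms by fastforce
  then show thesis
    using that[of z] by simp
qed

text \<open>Injectivity identifies the \<open>z\<close> selected in the definition; then
  \<open>m = - (y + 1) / z\<close> and \<open>z * m + 1 = - y\<close>.\<close>

lemma S_transform_real_y:
  assumes "z < 0"
  shows "S_transform M (real_y z) = of_real ((real_y z + 1) / (z * real_y z))"
proof -
  have "(THE w. w < 0 \<and> y_fun M (complex_of_real w) = complex_of_real (real_y z)) = z"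
    using assms real_y_inj by (intro the_equality) (auto simp: y_fun_of_real)
  then have "S_transform M (real_y z) =
      of_real (real_stieltjes z) / (of_real z * of_real (real_stieltjes z) + 1)"
    by (simp add: S_transform_def Let_def stieltjes_of_real)
  also have "\<dots> = of_real (real_stieltjes z / (z * real_stieltjes z + 1))"
    by simp
  also have "z * real_stieltjes z + 1 = - real_y z"
    by (simp add: real_y_def)
  also have "real_stieltjes z / - real_y z = (real_y z + 1) / (z * real_y z)"
    unfolding real_stieltjes_eq[OF assms]
    by (simp only: divide_divide_eq_left mult_minus_right minus_divide_divide)
  finally show ?thesis .
qed

end

section \<open>The point mass at 0 and the closure theorem\<close>

lemma nonneg_real_distributionI: "nonneg_distribution M \<Longrightarrow> nonneg_real_distribution M"
  by (simp add: nonneg_distribution_def nonneg_real_distribution_def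
      nonneg_real_distribution_axioms_def)

text \<open>The transform is \<open>- 1 / z\<close>, so the witness is the polynomial
  \<open>1 + z * m\<close>.\<close>

lemma algebraic_distribution_return_0: "algebraic_distribution (return borel 0)"
  unfolding algebraic_distribution_def
proof (intro exI[of _ "[:1, [:0, 1:]:]"] conjI allI impI)
  fix z :: complex assume "0 < Im z"
  moreover have "stieltjes (return borel 0) z = - 1 / z"
    unfolding stieltjes_def by (subst integral_return) auto
  ultimately show "poly_mz [:1, [:0, 1:]:] (stieltjes (return borel 0) z) z = 0"
    by (auto simp: poly_mz_pCons poly_mz_0)
qed simp

theorem corollary9p6:
  fixes A B C :: "real measure"
  assumes "nonneg_distribution A" and "algebraic_distribution A"
    and "nonneg_distribution B" and "algebraic_distribution B"
    and "is_free_mult_conv A B C"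
  shows "nonneg_distribution C \<and> algebraic_distribution C"
proof
  show C: "nonneg_distribution C"
    using assms(5) by (simp add: is_free_mult_conv_def)
  show "algebraic_distribution C"
  proof (cases "A = return borel 0 \<or> B = return borel 0")
    case True
    then show ?thesis
      using assms(5) algebraic_distribution_return_0 by (simp add: is_free_mult_conv_def)
  next
    case False
    then obtain \<epsilon> where \<epsilon>: "0 < \<epsilon>"
      "{- \<epsilon><..<0} \<subseteq> S_domain A \<inter> S_domain B \<inter> S_domain C"
      "\<And>y. y \<in> {- \<epsilon><..<0} \<Longrightarrow> S_transform C y = S_transform A y * S_transform B y"
      using assms(5) unfolding is_free_mult_conv_def by auto
    \<comment> \<open>A nonempty S transform domain forces the mass at 0 below 1; the test point is
      \<open>- \<epsilon> / 2\<close>.\<close>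
    have nondegenerate: "nondegenerate_nonneg_distribution M"
      if "nonneg_distribution M" "{- \<epsilon><..<0} \<subseteq> S_domain M" for M
    proof -
      have "- \<epsilon> / 2 \<in> S_domain M"
        using \<epsilon>(1) that(2) by auto
      then show ?thesis
        using that(1) by (auto simp: S_domain_def nondegenerate_nonneg_distribution_def
            nondegenerate_nonneg_distribution_axioms_def intro: nonneg_real_distributionI)
    qed
    interpret A: nondegenerate_nonneg_distribution A
      using nondegenerate assms(1) \<epsilon>(2) by auto
    interpret B: nondegenerate_nonneg_distribution B
      using nondegenerate assms(3) \<epsilon>(2) by auto
    interpret C: nondegenerate_nonneg_distribution C
      using nondegenerate C \<epsilon>(2) by auto
    obtain L1 where L1: "L1 \<noteq> 0" "\<And>z. 0 < Im z \<Longrightarrow> poly_mz L1 (stieltjes A z) z = 0"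
      using assms(2) unfolding algebraic_distribution_def by blast
    obtain L2 where L2: "L2 \<noteq> 0" "\<And>z. 0 < Im z \<Longrightarrow> poly_mz L2 (stieltjes B z) z = 0"
      using assms(4) unfolding algebraic_distribution_def by blast
    obtain L where L: "L \<noteq> 0"
      "\<And>y z z1 z2. \<lbrakk>y \<noteq> 0; z \<noteq> 0; z1 \<noteq> 0; z2 \<noteq> 0; z1 * z2 = z * (y + 1) / y;
         eval2 L1 (- (y + 1) / z1) z1 = 0; eval2 L2 (- (y + 1) / z2) z2 = 0\<rbrakk>
        \<Longrightarrow> eval2 L (- (y + 1) / z) z = 0"
      using multiplicative_elimination[OF L1(1) L2(1)] by blast
    \<comment> \<open>Every \<open>y\<close> in the interval from \<open>b\<close> to 0 satisfies
      the S transform equation and is attained by both \<open>A.real_y\<close> and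
      \<open>B.real_y\<close>.\<close>
    define b where "b = max (- \<epsilon>) (max (A.real_y (- 1)) (B.real_y (- 1)))"
    have "b < 0"
      using \<epsilon>(1) A.real_y_neg[of "- 1"] B.real_y_neg[of "- 1"] by (simp add: b_def)
    then have "eventually (\<lambda>z. b < C.real_y z \<and> z < 0) at_bot"
      using order_tendstoD(1)[OF C.real_y_tendsto_0] eventually_gt_at_bot[of "0::real"]
      by (intro eventually_conj) auto
    then obtain c where c: "\<And>z. z \<le> c \<Longrightarrow> b < C.real_y z \<and> z < 0"
      unfolding eventually_at_bot_linorder by blast
    have "eval2 L (C.real_stieltjes z) z = 0" if "z < c" for z
    proof -
      define y where "y = C.real_y z"
      have z: "z < 0" and yb: "b < y"
        using c[of z] that by (simp_all add: y_def)
      have y0: "y < 0"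
        using C.real_y_neg[OF z] by (simp add: y_def)
      have y: "y \<in> {- \<epsilon><..<0}" "A.real_y (- 1) < y" "B.real_y (- 1) < y"
        using yb y0 by (auto simp: b_def)
      \<comment> \<open>The domain starts at the mass at 0 minus 1, hence \<open>y > - 1\<close>;
        this permits cancelling \<open>y + 1\<close> below.\<close>
      have "y \<in> S_domain C"
        using y(1) \<epsilon>(2) by blast
      then have "0 < y + 1"
        using measure_nonneg[of C "{0}"] unfolding S_domain_def greaterThanLessThan_iff
        by linarith
      obtain u where u: "u < 0" "A.real_y u = y"
        using A.real_y_surj y(2) y0 by blast
      obtain v where v: "v < 0" "B.real_y v = y"
        using B.real_y_surj y(3) y0 by blast
      have "complex_of_real ((y + 1) / (z * y)) =
          of_real ((y + 1) / (u * y)) * of_real ((y + 1) / (v * y))"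
        using \<epsilon>(3)[OF y(1)] A.S_transform_real_y[OF u(1)] B.S_transform_real_y[OF v(1)]
          C.S_transform_real_y[OF z] u(2) v(2) by (simp add: y_def)
      then have "(y + 1) / (z * y) = (y + 1) / (u * y) * ((y + 1) / (v * y))"
        by (metis of_real_eq_iff of_real_mult)
      \<comment> \<open>Cancelling one factor \<open>(y + 1) / y\<close> in the S transform equation
        gives exactly the product relation of the elimination lemma.\<close>
      then have "u * v = z * (y + 1) / y"
        using \<open>0 < y + 1\<close> y0 u(1) v(1) z by (simp add: divide_simps) (simp add: mult_ac)
      moreover have "eval2 L1 (- (y + 1) / u) u = 0"
        using A.algebraic_relation_negative_axis[OF L1(2) u(1)]
        by (simp add: A.real_stieltjes_eq u)
      moreover have "eval2 L2 (- (y + 1) / v) v = 0"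
        using B.algebraic_relation_negative_axis[OF L2(2) v(1)]
        by (simp add: B.real_stieltjes_eq v)
      ultimately have "eval2 L (- (y + 1) / z) z = 0"
        using y0 z u(1) v(1) by (intro L(2)[of y z u v]) simp_all
      then show ?thesis
        using z by (simp add: C.real_stieltjes_eq y_def)
    qed
    \<comment> \<open>The relation holds to the left of \<open>c < 0\<close> and is continued from
      there.\<close>
    then have "poly_mz L (stieltjes C z) z = 0" if "0 < Im z" for z
      using C.algebraic_relation_upper_half_plane[of c L z] c[of c] that by simp
    then show ?thesis
      unfolding algebraic_distribution_def using L(1) by blast
  qed
qed

end
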